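(* Let $\mathfrak{g}$ be a finite dimensional complex quadratic Lie algebra with bilinear form $B$, and let $\partial$ be the Chevalley differential of $\bigwedge\mathfrak{g}$ (trivial cohomology complex). Define $I(X,Y,Z):=B([X,Y],Z)$ for $X,Y,Z\in\mathfrak{g}$. Then: (1) $I\in(\bigwedge^3\mathfrak{g})^{\mathfrak{g}}$; (2) $\partial=-\frac12\,\mathrm{ad}_P(I)$; (3) $\{I,I\}=0$.
   Context: A quadratic Lie algebra is a Lie algebra with a non degenerate symmetric invariant bilinear form $B$. $\bigwedge\mathfrak{g}=\sum_p\bigwedge^p\mathfrak{g}$ is the algebra of skew symmetric multilinear forms on $\mathfrak{g}$, with the wedge product $(\Omega\wedge\Omega')(Y_1,\dots,Y_{p+q})=\sum_{\sigma}\varepsilon(\sigma)\Omega(Y_{\sigma(1)},\dots,Y_{\sigma(p)})\Omega'(Y_{\sigma(p+1)},\dots,Y_{\sigma(p+q)})$, the sum over permutations with $\sigma(1)<\dots<\sigma(p)$, $\sigma(p+1)<\dots<\sigma(p+q)$. $\iota_X\Omega(Y_1,\dots)=\Omega(X,Y_1,\dots)$ and $\iota_X(1)=0$. $(\bigwedge\mathfrak{g})^{\mathfrak{g}}$ is the space of forms with $\sum_i\Omega(Y_1,\dots,[X,Y_i],\dots,Y_p)=0$ for all $X,Y_i$. The differential is $\partial\Omega(Y_1,\dots,Y_{p+1})=\sum_{i<j}(-1)^{i+j}\Omega([Y_i,Y_j],Y_1,\dots,\widehat{Y_i},\dots,\widehat{Y_j},\dots,Y_{p+1})$. The super Poisson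 bracket on $\bigwedge\mathfrak{g}$ (depending on $B$) is $\{\Omega,\Omega'\}=2(-1)^{w+1}\sum_{j=1}^n\iota_{X_j}(\Omega)\wedge\iota_{X_j}(\Omega')$ for $\Omega\in\bigwedge^w\mathfrak{g}$, $\Omega'\in\bigwedge\mathfrak{g}$, where $\{X_1,\dots,X_n\}$ is any orthonormal basis of $\mathfrak{g}$ for $B$; $\mathrm{ad}_P(\Omega)=\{\Omega,\cdot\}$. *)

theory Defs
  imports Complex_Main "HOL-Combinatorics.Permutations"
begin

text \<open>
  The last axiom is invariance: \<^term>\<open>B\<close> is annihilated by every \<open>ad x\<close>.
  The set \<^term>\<open>Basis\<close> is a vector space basis with no relation to \<^term>\<open>B\<close>; it only
  witnesses finite dimensionality.
\<close>

locale quadratic_lie_algebra = finite_dimensional_vector_space scale Basis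
  for scale :: "complex \<Rightarrow> 'g::ab_group_add \<Rightarrow> 'g" and Basis :: "'g set" +
  fixes br :: "'g \<Rightarrow> 'g \<Rightarrow> 'g"
    and B :: "'g \<Rightarrow> 'g \<Rightarrow> complex"
  assumes br_linear_left: "Vector_Spaces.linear scale scale (\<lambda>x. br x y)"
    and br_linear_right: "Vector_Spaces.linear scale scale (br x)"
    and br_alternating: "br x x = 0"
    and jacobi: "br x (br y z) + br y (br z x) + br z (br x y) = 0"
    and B_linear_left: "Vector_Spaces.linear scale (*) (\<lambda>x. B x y)"
    and B_linear_right: "Vector_Spaces.linear scale (*) (B x)"
    and B_sym: "B x y = B y x"
    and B_nondegenerate: "(\<And>y. B x y = 0) \<Longrightarrow> x = 0"
    and B_invariant: "B (br x y) z + B y (br x z) = 0"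

text \<open>
  A \<open>p\<close>-form is a function on lists of vectors which vanishes on lists of length different
  from \<open>p\<close>. A sum of forms of several degrees is then again a function on lists, whose
  restriction to lists of length \<open>p\<close> is its component of degree \<open>p\<close>; scalars are the
  values on the empty list.
\<close>

type_synonym 'g form = "'g list \<Rightarrow> complex"

definition alt_forms :: "(complex \<Rightarrow> 'g::ab_group_add \<Rightarrow> 'g) \<Rightarrow> nat \<Rightarrow> 'g form set" where
  "alt_forms scale p = {\<omega>.
     (\<forall>ys. length ys \<noteq> p \<longrightarrow> \<omega> ys = 0) \<and>
     (\<forall>ys i. length ys = p \<longrightarrow> i < p \<longrightarrow>
        Vector_Spaces.linear scale (*) (\<lambda>x. \<omega> (ys[i := x]))) \<and>
     (\<forall>ys \<sigma>. length ys = p \<longrightarrow> \<sigma> permutes {..<p} \<longrightarrow>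
        \<omega> (permute_list \<sigma> ys) = of_int (sign \<sigma>) * \<omega> ys)}"

definition ext_alg :: "(complex \<Rightarrow> 'g::ab_group_add \<Rightarrow> 'g) \<Rightarrow> 'g form set" where
  "ext_alg scale = {\<omega>. \<exists>N \<alpha>. (\<forall>p\<le>N. \<alpha> p \<in> alt_forms scale p) \<and> \<omega> = (\<lambda>ys. \<Sum>p\<le>N. \<alpha> p ys)}"

definition hom_part :: "nat \<Rightarrow> 'g form \<Rightarrow> 'g form" where
  "hom_part p \<omega> = (\<lambda>ys. if length ys = p then \<omega> ys else 0)"

definition invariant_form :: "('g \<Rightarrow> 'g \<Rightarrow> 'g) \<Rightarrow> 'g form \<Rightarrow> bool" where
  "invariant_form br \<omega> \<longleftrightarrow> (\<forall>x ys. (\<Sum>i<length ys. \<omega> (ys[i := br x (ys ! i)])) = 0)"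

definition shuffle_perms :: "nat \<Rightarrow> nat \<Rightarrow> (nat \<Rightarrow> nat) set" where
  "shuffle_perms p q = {\<sigma>. \<sigma> permutes {..<p + q} \<and>
     strict_mono_on {..<p} \<sigma> \<and> strict_mono_on {p..<p + q} \<sigma>}"

text \<open>
  The sum over \<^term>\<open>p\<close> is the bilinear extension of the wedge product to inhomogeneous
  arguments: on forms of degree \<open>p\<close> and \<open>q\<close>, evaluated at \<open>p + q\<close> vectors, only the
  summand with index \<open>p\<close> survives.
\<close>

definition wedge :: "'g form \<Rightarrow> 'g form \<Rightarrow> 'g form" where
  "wedge \<omega> \<eta> = (\<lambda>ys. \<Sum>p\<le>length ys. \<Sum>\<sigma>\<in>shuffle_perms p (length ys - p).
     of_int (sign \<sigma>) * \<omega> (take p (permute_list \<sigma> ys)) * \<eta> (drop p (permute_list \<sigma> ys)))"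

definition iota :: "'g \<Rightarrow> 'g form \<Rightarrow> 'g form" where
  "iota x \<omega> = (\<lambda>ys. \<omega> (x # ys))"

text \<open>Indices start at 0, which does not change the parity of \<^term>\<open>i + j\<close>.\<close>

definition chevalley_d :: "('g \<Rightarrow> 'g \<Rightarrow> 'g) \<Rightarrow> 'g form \<Rightarrow> 'g form" where
  "chevalley_d br \<omega> = (\<lambda>ys. \<Sum>j<length ys. \<Sum>i<j.
     (- 1) ^ (i + j) * \<omega> (br (ys ! i) (ys ! j) # nths ys (- {i, j})))"

definition orthonormal_basis ::
    "(complex \<Rightarrow> 'g::ab_group_add \<Rightarrow> 'g) \<Rightarrow> ('g \<Rightarrow> 'g \<Rightarrow> complex) \<Rightarrow> 'g set \<Rightarrow> bool" where
  "orthonormal_basis scale B E \<longleftrightarrow>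
     finite E \<and> \<not> module.dependent scale E \<and> module.span scale E = UNIV \<and>
     (\<forall>x\<in>E. \<forall>y\<in>E. B x y = (if x = y then 1 else 0))"

text \<open>
  The sum over \<^term>\<open>w\<close> extends the bracket linearly to inhomogeneous first arguments; at a
  list \<open>ys\<close>, components of degree larger than \<open>length ys + 1\<close> do not contribute.
  An orthonormal basis exists (\<open>orthonormal_basis_exists\<close> below), and the bracket is given
  by the usual formula in any of them (\<open>poisson_eq\<close> below).
\<close>

definition poisson ::
    "(complex \<Rightarrow> 'g::ab_group_add \<Rightarrow> 'g) \<Rightarrow> ('g \<Rightarrow> 'g \<Rightarrow> complex) \<Rightarrow> 'g form \<Rightarrow> 'g form \<Rightarrow> 'g form"
  where
  "poisson scale B \<omega> \<eta> = (\<lambda>ys. \<Sum>w\<le>Suc (length ys).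
     2 * (- 1) ^ (w + 1) *
     (\<Sum>e\<in>(SOME E. orthonormal_basis scale B E). wedge (iota e (hom_part w \<omega>)) (iota e \<eta>) ys))"

definition ad_P ::
    "(complex \<Rightarrow> 'g::ab_group_add \<Rightarrow> 'g) \<Rightarrow> ('g \<Rightarrow> 'g \<Rightarrow> complex) \<Rightarrow> 'g form \<Rightarrow> 'g form \<Rightarrow> 'g form"
  where "ad_P scale B \<omega> = poisson scale B \<omega>"

definition structure_form :: "('g \<Rightarrow> 'g \<Rightarrow> 'g) \<Rightarrow> ('g \<Rightarrow> 'g \<Rightarrow> complex) \<Rightarrow> 'g form" where
  "structure_form br B = (\<lambda>ys. case ys of [x, y, z] \<Rightarrow> B (br x y) z | _ \<Rightarrow> 0)"

context quadratic_lie_algebra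
begin

lemma B_simps:
  "B (x + y) z = B x z + B y z" "B (scale c x) z = c * B x z" "B 0 z = 0" "B (x - y) z = B x z - B y z"
  "B z (x + y) = B z x + B z y" "B z (scale c x) = c * B z x" "B z 0 = 0" "B z (x - y) = B z x - B z y"
  "B (sum f A) z = (\<Sum>a\<in>A. B (f a) z)" "B z (sum f A) = (\<Sum>a\<in>A. B z (f a))"
proof -
  interpret l: Vector_Spaces.linear scale "(*)" "\<lambda>x. B x z" by (rule B_linear_left)
  interpret r: Vector_Spaces.linear scale "(*)" "B z" by (rule B_linear_right)
  show "B (x + y) z = B x z + B y z" "B (scale c x) z = c * B x z" "B 0 z = 0"
    "B (x - y) z = B x z - B y z"
    "B z (x + y) = B z x + B z y" "B z (scale c x) = c * B z x" "B z 0 = 0"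
    "B z (x - y) = B z x - B z y"
    "B (sum f A) z = (\<Sum>a\<in>A. B (f a) z)" "B z (sum f A) = (\<Sum>a\<in>A. B z (f a))"
    by (rule l.add l.scale l.zero l.diff l.sum r.add r.scale r.zero r.diff r.sum)+
qed

definition orthonormal :: "'g set \<Rightarrow> bool" where
  "orthonormal E \<longleftrightarrow> finite E \<and> (\<forall>x\<in>E. \<forall>y\<in>E. B x y = (if x = y then 1 else 0))"

lemma B_orthonormal_sum:
  assumes "orthonormal E" "e \<in> E"
  shows "B (\<Sum>x\<in>E. scale (u x) x) e = u e"
proof -
  have "B (\<Sum>x\<in>E. scale (u x) x) e = (\<Sum>x\<in>E. if x = e then u x else 0)"
    using assms unfolding B_simps by (intro sum.cong) (auto simp: orthonormal_def)
  then show ?thesis using assms by (simp add: orthonormal_def)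
qed

lemma orthonormal_independent:
  assumes "orthonormal E" shows "independent E"
proof (rule independent_if_scalars_zero)
  show "finite E" using assms by (simp add: orthonormal_def)
  fix u e assume "(\<Sum>x\<in>E. scale (u x) x) = 0" "e \<in> E"
  then show "u e = 0" using B_orthonormal_sum[OF assms, of e u] by (simp add: B_simps)
qed

lemma orthonormal_basis_exists: "\<exists>E. orthonormal_basis scale B E"
proof -
  have bound: "card E < Suc (dim UNIV)" if "orthonormal E" for E
    using independent_card_le_dim[OF subset_UNIV orthonormal_independent[OF that]] by (simp add: less_Suc_eq_le)
  have "orthonormal {}" by (simp add: orthonormal_def)
  then obtain E where E: "orthonormal E" and max: "\<And>F. orthonormal F \<Longrightarrow> card F \<le> card E"
    using ex_has_greatest_nat[of orthonormal "{}" card "Suc (dim UNIV)"] bound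
    by (metis less_imp_le)
  have fin: "finite E" using E by (simp add: orthonormal_def)
  have "span E = UNIV"
  proof (rule ccontr)
    assume "span E \<noteq> UNIV"
    then obtain x where x: "x \<notin> span E" by auto
    define r where "r z = z - (\<Sum>e\<in>E. scale (B z e) e)" for z
    have r: "B (r z) e = 0" if "e \<in> E" for z e
      using B_orthonormal_sum[OF E that, of "\<lambda>e. B z e"] by (simp add: r_def B_simps)
    have in_span: "(\<Sum>e\<in>E. scale (c e) e) \<in> span E" for c
      by (intro span_sum span_scale span_base)
    have "r x \<noteq> 0" using x in_span[of "B x"] by (auto simp: r_def)
    have iso: "B y y = 0" if y: "\<And>e. e \<in> E \<Longrightarrow> B y e = 0" for y
    proof (rule ccontr)
      assume ne: "B y y \<noteq> 0"
      define c where "c = csqrt (B y y)"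
      have c: "c * c = B y y" "c \<noteq> 0"
        using ne power2_csqrt[of "B y y"] by (auto simp: c_def power2_eq_square)
      define y' where "y' = scale (1 / c) y"
      have yy: "B y' y' = 1" using c(2) by (simp add: y'_def B_simps c(1)[symmetric])
      have ye: "B y' e = 0" "B e y' = 0" if "e \<in> E" for e
        using y[OF that] B_sym[of e y] by (simp_all add: y'_def B_simps)
      have "y' \<notin> E" using yy ye by fastforce
      moreover have "orthonormal (insert y' E)"
        using E yy ye \<open>y' \<notin> E\<close> by (auto simp: orthonormal_def)
      ultimately show False using max[of "insert y' E"] fin by simp
    qed
    have "B (r x) z = 0" for z
    proof -
      have "B (r x + r z) (r x + r z) = 0" "B (r x) (r x) = 0" "B (r z) (r z) = 0"
        by (intro iso; simp add: B_simps r)+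
      then have "B (r x) (r z) = 0" using B_sym[of "r z" "r x"] by (simp add: B_simps)
      then show ?thesis by (simp add: r_def[of z] B_simps r)
    qed
    then show False using B_nondegenerate \<open>r x \<noteq> 0\<close> by blast
  qed
  then have "orthonormal_basis scale B E"
    using E orthonormal_independent[OF E] by (simp add: orthonormal_basis_def orthonormal_def)
  then show ?thesis ..
qed

lemma orthonormal_expansion:
  assumes "orthonormal_basis scale B E"
  shows "x = (\<Sum>e\<in>E. scale (B x e) e)"
proof -
  have E: "orthonormal E" "finite E" "span E = UNIV"
    using assms by (auto simp: orthonormal_basis_def orthonormal_def)
  have "x \<in> range (\<lambda>u. \<Sum>e\<in>E. scale (u e) e)"
    using E(3) by (simp flip: span_finite[OF E(2)])
  then obtain u where u: "x = (\<Sum>e\<in>E. scale (u e) e)" by auto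
  have "B x e = u e" if "e \<in> E" for e
    using B_orthonormal_sum[OF E(1) that, of u] u by simp
  then show ?thesis using u by simp
qed

lemma contraction_basis_independent:
  assumes E: "orthonormal_basis scale B E" and F: "orthonormal_basis scale B F"
    and a: "Vector_Spaces.linear scale (*) a" and b: "Vector_Spaces.linear scale (*) b"
  shows "(\<Sum>e\<in>E. a e * b e) = (\<Sum>f\<in>F. a f * b f)"
proof -
  interpret a: Vector_Spaces.linear scale "(*)" a by (rule a)
  interpret b: Vector_Spaces.linear scale "(*)" b by (rule b)
  have "a e * b e = (\<Sum>f\<in>F. a f * (B f e * b e))" for e
  proof -
    have "a e = (\<Sum>f\<in>F. B e f * a f)"
      by (subst orthonormal_expansion[OF F, of e]) (simp only: a.sum a.scale)
    also have "\<dots> = (\<Sum>f\<in>F. a f * B f e)"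
      by (intro sum.cong refl) (metis B_sym mult.commute)
    finally have "a e * b e = (\<Sum>f\<in>F. a f * B f e) * b e" by (rule arg_cong)
    then show ?thesis by (simp only: sum_distrib_right mult.assoc)
  qed
  then have "(\<Sum>e\<in>E. a e * b e) = (\<Sum>e\<in>E. \<Sum>f\<in>F. a f * (B f e * b e))" by simp
  also have "\<dots> = (\<Sum>f\<in>F. a f * (\<Sum>e\<in>E. B f e * b e))"
    by (subst sum.swap) (simp add: sum_distrib_left)
  also have "\<dots> = (\<Sum>f\<in>F. a f * b f)"
  proof (intro sum.cong refl)
    fix f
    have "b f = (\<Sum>e\<in>E. B f e * b e)"
      by (subst orthonormal_expansion[OF E, of f]) (simp only: b.sum b.scale)
    then show "a f * (\<Sum>e\<in>E. B f e * b e) = a f * b f" by simp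
  qed
  finally show ?thesis .
qed

lemma alt_forms_linear_head:
  assumes "\<omega> \<in> alt_forms scale p"
  shows "Vector_Spaces.linear scale (*) (\<lambda>x. \<omega> (x # us))"
proof (cases "p = Suc (length us)")
  case True
  then show ?thesis using assms unfolding alt_forms_def
    by (auto dest!: spec[of _ "0 # us"] spec[of _ "0::nat"])
next
  case False
  have "(\<lambda>x. \<omega> (x # us)) = (\<lambda>_. 0)" using assms False by (auto simp: alt_forms_def)
  moreover have "B 0 = (\<lambda>_. 0)" by (simp add: B_simps fun_eq_iff)
  ultimately show ?thesis using B_linear_right[of 0] by simp
qed

lemma ext_alg_linear_head:
  assumes "\<eta> \<in> ext_alg scale"
  shows "Vector_Spaces.linear scale (*) (\<lambda>x. \<eta> (x # us))"
proof -
  obtain N \<alpha> where \<alpha>: "\<And>p. p \<le> N \<Longrightarrow> \<alpha> p \<in> alt_forms scale p"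
    and \<eta>: "\<eta> = (\<lambda>ys. \<Sum>p\<le>N. \<alpha> p ys)"
    using assms by (auto simp: ext_alg_def)
  interpret vp: vector_space_pair scale "(*) :: complex \<Rightarrow> complex \<Rightarrow> complex"
    using B_linear_right[of 0] by (simp add: vector_space_pair_def linear_def module_hom_def
      vector_space_axioms) (simp add: Vector_Spaces.linear_def)
  show ?thesis unfolding \<eta>
    by (intro vp.linear_compose_sum) (simp add: alt_forms_linear_head[OF \<alpha>])
qed

lemma wedge_basis_independent:
  assumes E: "orthonormal_basis scale B E" and F: "orthonormal_basis scale B F"
    and \<omega>: "\<omega> \<in> alt_forms scale w" and \<eta>: "\<eta> \<in> ext_alg scale"
  shows "(\<Sum>e\<in>E. wedge (iota e \<omega>) (iota e \<eta>) ys) = (\<Sum>e\<in>F. wedge (iota e \<omega>) (iota e \<eta>) ys)"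
proof -
  have swap: "(\<Sum>e\<in>G. wedge (iota e \<omega>) (iota e \<eta>) ys) =
    (\<Sum>p\<le>length ys. \<Sum>\<sigma>\<in>shuffle_perms p (length ys - p). of_int (sign \<sigma>) *
      (\<Sum>e\<in>G. \<omega> (e # take p (permute_list \<sigma> ys)) * \<eta> (e # drop p (permute_list \<sigma> ys))))" for G
    unfolding wedge_def iota_def sum_distrib_left mult.assoc
    by (subst sum.swap, intro sum.cong refl, rule sum.swap)
  show ?thesis unfolding swap
    using contraction_basis_independent[OF E F alt_forms_linear_head[OF \<omega>] ext_alg_linear_head[OF \<eta>]]
    by simp
qed

lemma poisson_eq:
  assumes E: "orthonormal_basis scale B E"
    and \<omega>: "\<omega> \<in> alt_forms scale w" and \<eta>: "\<eta> \<in> ext_alg scale"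
  shows "poisson scale B \<omega> \<eta> =
    (\<lambda>ys. 2 * (- 1) ^ (w + 1) * (\<Sum>e\<in>E. wedge (iota e \<omega>) (iota e \<eta>) ys))"
proof
  fix ys
  define F where "F = (SOME E. orthonormal_basis scale B E)"
  have F: "orthonormal_basis scale B F" unfolding F_def by (rule someI_ex[OF orthonormal_basis_exists])
  have zero: "\<omega> us = 0" if "length us \<noteq> w" for us using \<omega> that by (simp add: alt_forms_def)
  have same: "hom_part w \<omega> = \<omega>" using zero by (auto simp: hom_part_def)
  have other: "hom_part v \<omega> = (\<lambda>_. 0)" if "v \<noteq> w" for v using zero that by (auto simp: hom_part_def)
  have wedge0: "wedge (iota e (\<lambda>_. 0)) (iota e \<eta>) ys = 0" for e
    by (simp add: wedge_def iota_def)
  have "poisson scale B \<omega> \<eta> ys = (\<Sum>v\<le>Suc (length ys). if v = w then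
      2 * (- 1) ^ (w + 1) * (\<Sum>e\<in>F. wedge (iota e \<omega>) (iota e \<eta>) ys) else 0)"
    unfolding poisson_def F_def[symmetric] by (intro sum.cong refl) (auto simp: same other wedge0)
  also have "\<dots> = 2 * (- 1) ^ (w + 1) * (\<Sum>e\<in>F. wedge (iota e \<omega>) (iota e \<eta>) ys)"
  proof (cases "w \<le> Suc (length ys)")
    case False
    then have "wedge (iota e \<omega>) (iota e \<eta>) ys = 0" for e
      unfolding wedge_def iota_def by (intro sum.neutral ballI) (auto simp: zero)
    then show ?thesis using False by simp
  qed (simp add: sum.delta)
  also have "\<dots> = 2 * (- 1) ^ (w + 1) * (\<Sum>e\<in>E. wedge (iota e \<omega>) (iota e \<eta>) ys)"
    using wedge_basis_independent[OF F E \<omega> \<eta>] by simp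
  finally show "poisson scale B \<omega> \<eta> ys =
    2 * (- 1) ^ (w + 1) * (\<Sum>e\<in>E. wedge (iota e \<omega>) (iota e \<eta>) ys)" .
qed

end

end

theory Submission
  imports Defs
begin

text \<open>
  Invariance gives \<open>I(e, a, b) = B(e, [a, b])\<close>, so contracting \<open>I\<close> with a form over an
  orthonormal basis inserts \<open>[a, b]\<close> into that form. Hence \<open>{I, \<omega>}\<close> is a sum over
  \<open>(2, n - 2)\<close>-shuffles of terms \<open>\<omega>([y\<^sub>i, y\<^sub>j], \<dots>)\<close>. Such a shuffle is determined by the images
  \<open>i < j\<close> of its first two points and has sign \<open>(-1)^(i + j + 1)\<close>, which identifies the
  sum with \<open>- 2 \<partial>\<omega>\<close>. Finally \<open>{I, I} = - 2 \<partial>I\<close> vanishes by the Jacobi identity.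
\<close>

section \<open>Shuffles of type \<open>(2, m)\<close> and their signs\<close>

text \<open>The increasing enumeration of the complement of \<open>{i, j}\<close> is spelled out in
  three ranges. All points beyond \<open>j\<close> are fixed, so one function serves every total
  degree \<open>n > j\<close>.\<close>

definition two_shuffle :: "nat \<Rightarrow> nat \<Rightarrow> nat \<Rightarrow> nat" where
  "two_shuffle i j t =
     (if t = 0 then i else if t = 1 then j
      else if t < i + 2 then t - 2 else if t \<le> j then t - 1 else t)"

lemma two_shuffle_0_1: "two_shuffle 0 (Suc 0) = id"
  by (auto simp: two_shuffle_def fun_eq_iff)

lemma two_shuffle_Suc_right:
  "i < j \<Longrightarrow> two_shuffle i (Suc j) = transpose j (Suc j) \<circ> two_shuffle i j"
  by (auto simp: two_shuffle_def fun_eq_iff transpose_def)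

lemma two_shuffle_Suc_left:
  "Suc i < j \<Longrightarrow> two_shuffle (Suc i) j = transpose i (Suc i) \<circ> two_shuffle i j"
  by (auto simp: two_shuffle_def fun_eq_iff transpose_def)

text \<open>Starting from the identity at \<open>(0, 1)\<close>, first \<open>j\<close> and then
  \<open>i\<close> is raised one unit at a time. Each of the \<open>i + j - 1\<close> steps composes
  with an adjacent transposition and flips the sign.\<close>

lemma two_shuffle_permutes_sign:
  assumes "i < j" "j < n"
  shows "two_shuffle i j permutes {..<n} \<and> sign (two_shuffle i j) = (- 1) ^ (i + j + 1)"
proof -
  have step: "transpose k (Suc k) \<circ> p permutes {..<n} \<and>
      sign (transpose k (Suc k) \<circ> p) = (- 1) ^ Suc m"
    if "p permutes {..<n} \<and> sign p = (- 1) ^ m" "Suc k < n" for p k m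
  proof
    have p: "permutation p" using that by (auto simp: permutation_permutes)
    show "transpose k (Suc k) \<circ> p permutes {..<n}"
      using that by (intro permutes_compose permutes_swap_id) auto
    show "sign (transpose k (Suc k) \<circ> p) = (- 1) ^ Suc m"
      using that p by (simp add: sign_compose permutation_swap_id sign_swap_id)
  qed
  have base: "two_shuffle 0 j permutes {..<n} \<and> sign (two_shuffle 0 j) = (- 1) ^ (j + 1)"
    if "0 < j" "j < n" for j
    using that
  proof (induction j)
    case (Suc j)
    show ?case
    \<comment> \<open>The induction effectively starts at \<open>two_shuffle 0 1\<close>, since
      \<open>two_shuffle 0 0\<close> is not injective.\<close>
    proof (cases "j = 0")
      case True
      then show ?thesis using permutes_id by (simp add: two_shuffle_0_1 flip: id_def)
    next
      case False
      with Suc have "two_shuffle 0 j permutes {..<n} \<and> sign (two_shuffle 0 j) = (- 1) ^ (j + 1)"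
        by simp
      from step[OF this Suc.prems(2)] False show ?thesis
        by (simp add: two_shuffle_Suc_right o_def)
    qed
  qed simp
  show ?thesis using assms(1)
  proof (induction i)
    case 0
    then show ?case using base assms(2) by simp
  next
    case (Suc i)
    then have "two_shuffle i j permutes {..<n} \<and> sign (two_shuffle i j) = (- 1) ^ (i + j + 1)"
      by simp
    from step[OF this, of i] Suc.prems assms(2) show ?case
      by (simp add: two_shuffle_Suc_left o_def)
  qed
qed

lemma two_shuffle_in_shuffle_perms:
  assumes "i < j" "j < m + 2"
  shows "two_shuffle i j \<in> shuffle_perms 2 m"
proof -
  have "two_shuffle i j permutes {..<2 + m}"
    using two_shuffle_permutes_sign[of i j "2 + m"] assms by simp
  then show ?thesis using assms
    by (auto simp: shuffle_perms_def strict_mono_on_def two_shuffle_def)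
qed

text \<open>Both sides are increasing lists with the same set of entries. This yields the uniqueness
  of the shuffle as well as the arguments left for the second factor of a wedge product.\<close>

lemma shuffle_perms_2_map:
  assumes "\<sigma> \<in> shuffle_perms 2 m"
  shows "map \<sigma> [2..<m + 2] = filter (\<lambda>k. k \<noteq> \<sigma> 0 \<and> k \<noteq> \<sigma> 1) [0..<m + 2]"
proof (rule sorted_distinct_set_unique)
  have p: "\<sigma> permutes {..<m + 2}" and s: "strict_mono_on {2..<m + 2} \<sigma>"
    using assms by (auto simp: shuffle_perms_def add.commute)
  have inj: "inj \<sigma>" using p by (rule permutes_inj)
  show "sorted (map \<sigma> [2..<m + 2])"
    unfolding sorted_map by (rule sorted_wrt_mono_rel[OF _ sorted_wrt_upt])
      (use s in \<open>auto simp: strict_mono_on_def intro: less_imp_le\<close>)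
  show "distinct (map \<sigma> [2..<m + 2])"
    using inj by (simp add: distinct_map inj_on_subset[OF inj])
  have "{2..<m + 2} = {..<m + 2} - {0, 1}" by auto
  then have image: "\<sigma> ` {2..<m + 2} = {..<m + 2} - {\<sigma> 0, \<sigma> 1}"
    using permutes_image[OF p] by (simp add: image_set_diff[OF inj])
  show "set (map \<sigma> [2..<m + 2]) = set (filter (\<lambda>k. k \<noteq> \<sigma> 0 \<and> k \<noteq> \<sigma> 1) [0..<m + 2])"
    unfolding set_map set_filter set_upt image by auto
qed (simp_all add: sorted_wrt_filter del: upt_Suc)

lemma shuffle_perms_2_less:
  assumes "\<sigma> \<in> shuffle_perms 2 m"
  shows "\<sigma> 0 < \<sigma> 1" "\<sigma> 1 < m + 2"
  using assms permutes_in_image[of \<sigma> "{..<2 + m}" 1]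
  by (auto simp: shuffle_perms_def strict_mono_on_def)

text \<open>Two shuffles with the same first two images have the same remaining images in the same
  order, and both fix every point from \<open>m + 2\<close> on.\<close>

lemma shuffle_perms_2_eq_two_shuffle:
  assumes "\<sigma> \<in> shuffle_perms 2 m"
  shows "\<sigma> = two_shuffle (\<sigma> 0) (\<sigma> 1)"
proof
  fix t
  let ?\<tau> = "two_shuffle (\<sigma> 0) (\<sigma> 1)"
  have \<tau>: "?\<tau> \<in> shuffle_perms 2 m"
    using two_shuffle_in_shuffle_perms shuffle_perms_2_less[OF assms] by blast
  have 01: "?\<tau> 0 = \<sigma> 0" "?\<tau> 1 = \<sigma> 1" by (simp_all add: two_shuffle_def)
  have "map \<sigma> [2..<m + 2] = map ?\<tau> [2..<m + 2]"
    unfolding shuffle_perms_2_map[OF assms] shuffle_perms_2_map[OF \<tau>] 01 ..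
  then have "\<sigma> t = ?\<tau> t" if "2 \<le> t" "t < m + 2"
    using that unfolding map_eq_conv by (metis atLeastLessThan_iff set_upt)
  moreover have "\<sigma> t = ?\<tau> t" if "m + 2 \<le> t"
    using that assms \<tau> by (auto simp: shuffle_perms_def permutes_def)
  moreover have "\<sigma> t = ?\<tau> t" if "t < 2" using that 01 by (auto simp: less_2_cases_iff)
  ultimately show "\<sigma> t = ?\<tau> t" by linarith
qed

lemma nths_conv_map_nth: "nths xs A = map ((!) xs) (filter (\<lambda>k. k \<in> A) [0..<length xs])"
proof -
  have "zip xs [0..<length xs] = map (\<lambda>k. (xs ! k, k)) [0..<length xs]"
    by (rule nth_equalityI) auto
  then show ?thesis by (simp add: nths_def filter_map o_def)
qed

lemma take_permute_list: "n \<le> length xs \<Longrightarrow> take n (permute_list \<sigma> xs) = map (\<lambda>i. xs ! \<sigma> i) [0..<n]"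
  by (simp add: permute_list_def take_map)

lemma drop_permute_shuffle_2:
  assumes "\<sigma> \<in> shuffle_perms 2 m" "length ys = m + 2"
  shows "drop 2 (permute_list \<sigma> ys) = nths ys (- {\<sigma> 0, \<sigma> 1})"
proof -
  have "drop 2 (permute_list \<sigma> ys) = map ((!) ys) (map \<sigma> [2..<m + 2])"
    by (simp only: permute_list_def drop_map drop_upt assms(2) list.map_comp o_def add_0)
  then show ?thesis
    using assms(2) unfolding shuffle_perms_2_map[OF assms(1)] nths_conv_map_nth by simp
qed

text \<open>Rewrites the sum over shuffles in the index pattern of \<open>chevalley_d\<close>; only
  the opposite sign remains.\<close>

lemma wedge_2_left:
  assumes "\<And>us. length us \<noteq> 2 \<Longrightarrow> \<alpha> us = 0"
  shows "wedge \<alpha> \<beta> ys = (\<Sum>j<length ys. \<Sum>i<j.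
    (- 1) ^ (i + j + 1) * \<alpha> [ys ! i, ys ! j] * \<beta> (nths ys (- {i, j})))"
proof (cases "2 \<le> length ys")
  case False
  then have "wedge \<alpha> \<beta> ys = 0"
    unfolding wedge_def by (intro sum.neutral ballI) (auto simp: assms)
  moreover have "(\<Sum>j<length ys. \<Sum>i<j.
    (- 1) ^ (i + j + 1) * \<alpha> [ys ! i, ys ! j] * \<beta> (nths ys (- {i, j}))) = 0"
    using False by (intro sum.neutral ballI) auto
  ultimately show ?thesis by simp
next
  case True
  then obtain m where m: "length ys = m + 2" by (metis add.commute le_Suc_ex)
  define f where "f i j = (- 1) ^ (i + j + 1) * \<alpha> [ys ! i, ys ! j] * \<beta> (nths ys (- {i, j}))" for i j
  let ?T = "\<lambda>p \<sigma>. of_int (sign \<sigma>) * \<alpha> (take p (permute_list \<sigma> ys)) * \<beta> (drop p (permute_list \<sigma> ys))"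
  \<comment> \<open>For \<open>p \<le> m + 2\<close> the first block has length exactly
    \<open>p\<close>, so \<open>\<alpha>\<close> kills every summand except
    \<open>p = 2\<close>.\<close>
  have "wedge \<alpha> \<beta> ys = (\<Sum>p\<le>m + 2. if p = 2 then \<Sum>\<sigma>\<in>shuffle_perms 2 m. ?T 2 \<sigma> else 0)"
    unfolding wedge_def m by (intro sum.cong refl) (auto simp: assms m intro!: sum.neutral)
  also have "\<dots> = (\<Sum>\<sigma>\<in>shuffle_perms 2 m. ?T 2 \<sigma>)" by simp
  also have "\<dots> = (\<Sum>\<sigma>\<in>shuffle_perms 2 m. f (\<sigma> 0) (\<sigma> 1))"
  proof (intro sum.cong refl)
    fix \<sigma> assume \<sigma>: "\<sigma> \<in> shuffle_perms 2 m"
    have "sign \<sigma> = (- 1) ^ (\<sigma> 0 + \<sigma> 1 + 1)"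
      using two_shuffle_permutes_sign shuffle_perms_2_less[OF \<sigma>] shuffle_perms_2_eq_two_shuffle[OF \<sigma>]
      by metis
    moreover have "take 2 (permute_list \<sigma> ys) = [ys ! \<sigma> 0, ys ! \<sigma> 1]"
      using m by (simp add: take_permute_list upt_rec)
    ultimately show "?T 2 \<sigma> = f (\<sigma> 0) (\<sigma> 1)"
      by (simp add: f_def drop_permute_shuffle_2[OF \<sigma> m])
  qed
  \<comment> \<open>A shuffle corresponds to the pair of its first two images, with inverse
    \<open>two_shuffle\<close>. The larger index comes first because it bounds the other
    one.\<close>
  also have "\<dots> = (\<Sum>(j, i)\<in>(SIGMA j:{..<m + 2}. {..<j}). f i j)"
    by (rule sum.reindex_bij_witness[where i = "\<lambda>(j, i). two_shuffle i j" and j = "\<lambda>\<sigma>. (\<sigma> 1, \<sigma> 0)"])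
      (auto simp: shuffle_perms_2_eq_two_shuffle[symmetric] shuffle_perms_2_less
        shuffle_perms_2_less[unfolded One_nat_def add_2_eq_Suc'] two_shuffle_in_shuffle_perms two_shuffle_def
        shuffle_perms_2_eq_two_shuffle[symmetric, unfolded One_nat_def])
  also have "\<dots> = (\<Sum>j<m + 2. \<Sum>i<j. f i j)" by (subst sum.Sigma) auto
  finally show ?thesis by (simp only: f_def m)
qed

section \<open>Skew symmetry from transpositions\<close>

lemma alternating_if_swaps:
  assumes swap: "\<And>ys a b. length ys = p \<Longrightarrow> a < p \<Longrightarrow> b < p \<Longrightarrow> a \<noteq> b \<Longrightarrow>
      \<omega> (permute_list (transpose a b) ys) = - \<omega> ys"
    and "\<sigma> permutes {..<p}" "length ys = p"
  shows "\<omega> (permute_list \<sigma> ys) = of_int (sign \<sigma>) * (\<omega> ys :: complex)"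
proof -
  \<comment> \<open>The list stays quantified: for \<open>transpose a b \<circ> q\<close> the
    induction hypothesis on \<open>q\<close> is applied to the list already transposed.\<close>
  have "\<sigma> permutes {..<p} \<and> (\<forall>ys. length ys = p \<longrightarrow> \<omega> (permute_list \<sigma> ys) = of_int (sign \<sigma>) * \<omega> ys)"
    using assms(2) finite_lessThan[of p]
  proof (induction rule: permutes_induct)
    case id
    then show ?case using permutes_id by (simp flip: id_def)
  next
    case (swap a b q)
    then have q: "q permutes {..<p}" and t: "transpose a b permutes {..<p}"
      by (auto intro: permutes_swap_id)
    have "\<omega> (permute_list (transpose a b \<circ> q) ys) = of_int (sign (transpose a b \<circ> q)) * \<omega> ys"
      if "length ys = p" for ys
    proof -
      have "permutation q" using q by (auto simp: permutation_permutes)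
      then have "sign (transpose a b \<circ> q) = - sign q"
        using swap by (simp add: sign_compose permutation_swap_id sign_swap_id)
      then show ?thesis
        using swap q that assms(1)[of ys a b] by (simp add: permute_list_compose)
    qed
    with permutes_compose[OF q t] show ?case by blast
  qed
  then show ?thesis using assms(3) by blast
qed

section \<open>Identities for the bracket and the invariant form\<close>

context quadratic_lie_algebra
begin

lemma br_add_left: "br (x + y) z = br x z + br y z"
  and br_add_right: "br z (x + y) = br z x + br z y"
  and br_minus_right: "br z (- x) = - br z x"
proof -
  interpret l: Vector_Spaces.linear scale scale "\<lambda>x. br x z" by (rule br_linear_left)
  interpret r: Vector_Spaces.linear scale scale "br z" by (rule br_linear_right)
  show "br (x + y) z = br x z + br y z" "br z (x + y) = br z x + br z y"
    "br z (- x) = - br z x"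
    by (rule l.add r.add r.neg)+
qed

lemma br_antisym: "br x y = - br y x"
  using br_alternating[of "x + y"]
  unfolding br_add_left br_add_right
  by (simp add: br_alternating eq_neg_iff_add_eq_0 add.commute)

lemma B_minus: "B (- x) y = - B x y" "B y (- x) = - B y x"
  using B_simps(4)[of 0 x y] B_simps(8)[of y 0 x] by (simp_all add: B_simps)

text \<open>The Jacobi identity in the form that \<open>br x\<close> is a derivation.\<close>

lemma br_derivation: "br x (br y z) = br (br x y) z + br y (br x z)"
proof -
  have "br y (br z x) = - br y (br x z)" "br z (br x y) = - br (br x y) z"
    using br_antisym[of z x] br_antisym[of z "br x y"] by (simp_all add: br_minus_right)
  then show ?thesis using jacobi[of x y z] by (simp add: algebra_simps)
qed

lemma B_br_assoc: "B (br x y) z = B x (br y z)"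
proof -
  have "B (br y x) z = - B x (br y z)"
    using B_invariant[of y x z] by (simp add: eq_neg_iff_add_eq_0)
  then show ?thesis by (simp add: br_antisym[of x y] B_minus)
qed

lemma B_br_swap12: "B (br y x) z = - B (br x y) z"
  using br_antisym[of y x] by (simp add: B_minus)

lemma B_br_swap23: "B (br x z) y = - B (br x y) z"
  using B_invariant[of x z y] B_sym[of "br x y" z] by (simp add: eq_neg_iff_add_eq_0)

text \<open>The transposition of the outer arguments is a product of three adjacent ones.\<close>

lemma B_br_swap13: "B (br z y) x = - B (br x y) z"
  using B_br_swap12[of z y x] B_br_swap23[of y z x] B_br_swap12[of x y z] by simp

section \<open>The form \<open>I\<close> as an invariant alternating 3-form\<close>

lemma structure_form_3: "structure_form br B [x, y, z] = B (br x y) z"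
  by (simp add: structure_form_def)

lemma structure_form_eq_0: "length ys \<noteq> 3 \<Longrightarrow> structure_form br B ys = 0"
  by (auto simp: structure_form_def numeral_3_eq_3 split: list.splits)

lemma structure_form_linear:
  assumes "length ys = 3" "i < 3"
  shows "Vector_Spaces.linear scale (*) (\<lambda>x. structure_form br B (ys[i := x]))"
proof -
  obtain a b c where ys: "ys = [a, b, c]"
    using assms(1) by (auto simp: numeral_3_eq_3 length_Suc_conv)
  have 0: "Vector_Spaces.linear scale (*) (\<lambda>x. B (br x b) c)"
    using Vector_Spaces.linear_compose[OF br_linear_left B_linear_left] by (simp add: o_def)
  have 1: "Vector_Spaces.linear scale (*) (\<lambda>x. B (br a x) c)"
    using Vector_Spaces.linear_compose[OF br_linear_right B_linear_left] by (simp add: o_def)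
  consider "i = 0" | "i = 1" | "i = 2" using assms(2) by linarith
  then show ?thesis
    by cases (simp_all add: ys structure_form_3 numeral_2_eq_2 0 1 B_linear_right)
qed

lemma structure_form_alt: "structure_form br B \<in> alt_forms scale 3"
proof -
  have swap: "structure_form br B (permute_list (transpose a b) ys) = - structure_form br B ys"
    if len: "length ys = 3" and ab: "a < 3" "b < 3" "a \<noteq> b" for ys a b
  proof -
    obtain x y z where ys: "ys = [x, y, z]"
      using len by (auto simp: numeral_3_eq_3 length_Suc_conv)
    have "a \<in> {0, 1, 2}" "b \<in> {0, 1, 2}" using ab by auto
    then show ?thesis using ab(3)
      by (auto simp: ys permute_list_def upt_rec structure_form_3 transpose_def numeral_2_eq_2
          B_br_swap12[of y x z] B_br_swap23[of x z y] B_br_swap13[of z y x])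
  qed
  show ?thesis unfolding alt_forms_def
    using structure_form_eq_0 structure_form_linear alternating_if_swaps[of 3 "structure_form br B", OF swap]
    by blast
qed

text \<open>By the derivation rule the first two of the three terms combine to
  \<open>B (br x (br a b)) c\<close>, which cancels the third by invariance of
  \<open>B\<close>.\<close>

lemma structure_form_invariant: "invariant_form br (structure_form br B)"
  unfolding invariant_form_def
proof (intro allI)
  fix x ys
  show "(\<Sum>i<length ys. structure_form br B (ys[i := br x (ys ! i)])) = 0"
  proof (cases "length ys = 3")
    case True
    then obtain a b c where ys: "ys = [a, b, c]" by (auto simp: numeral_3_eq_3 length_Suc_conv)
    have "B (br (br x a) b) c + B (br a (br x b)) c + B (br a b) (br x c) = 0"
      using B_invariant[of x "br a b" c] by (simp add: br_derivation[of x a b] B_simps)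
    then show ?thesis by (simp add: ys structure_form_3 numeral_2_eq_2 add.assoc)
  qed (simp add: structure_form_eq_0)
qed

lemma structure_form_ext_alg: "structure_form br B \<in> ext_alg scale"
proof -
  let ?\<alpha> = "\<lambda>p::nat. if p = 3 then structure_form br B else (\<lambda>_. 0)"
  \<comment> \<open>The zero map is \<open>B 0\<close>; its linearity makes the zero form a valid
    component in every degree other than 3.\<close>
  have "Vector_Spaces.linear scale (*) (\<lambda>_. 0 :: complex)"
    using B_linear_right[of 0] unfolding B_simps .
  then have "\<forall>p\<le>3. ?\<alpha> p \<in> alt_forms scale p"
    using structure_form_alt by (auto simp: alt_forms_def)
  moreover have "structure_form br B = (\<lambda>ys. \<Sum>p\<le>3. ?\<alpha> p ys)"
    by (simp add: fun_eq_iff if_distrib[of "\<lambda>f. f _"] cong: if_cong)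
  ultimately show ?thesis
    unfolding ext_alg_def by (intro CollectI exI[of _ 3] exI[of _ ?\<alpha>] conjI)
qed

section \<open>The bracket with \<open>I\<close> and the differential\<close>

text \<open>The coefficients are the coordinates of \<open>br a b\<close> in the basis
  \<open>E\<close>, and \<open>\<omega>\<close> is linear in its first argument.\<close>

lemma structure_form_contraction:
  assumes E: "orthonormal_basis scale B E" and \<omega>: "\<omega> \<in> ext_alg scale"
  shows "(\<Sum>e\<in>E. structure_form br B [e, a, b] * \<omega> (e # us)) = \<omega> (br a b # us)"
proof -
  interpret l: Vector_Spaces.linear scale "(*)" "\<lambda>x. \<omega> (x # us)"
    by (rule ext_alg_linear_head[OF \<omega>])
  have "\<omega> (br a b # us) = (\<Sum>e\<in>E. B (br a b) e * \<omega> (e # us))"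
    by (subst orthonormal_expansion[OF E, of "br a b"]) (simp only: l.sum l.scale)
  then show ?thesis by (simp add: structure_form_3 B_br_assoc[of _ a b] B_sym[of _ "br a b"])
qed

lemma poisson_structure_form:
  assumes \<omega>: "\<omega> \<in> ext_alg scale"
  shows "poisson scale B (structure_form br B) \<omega> ys = - 2 * chevalley_d br \<omega> ys"
proof -
  obtain E where E: "orthonormal_basis scale B E" using orthonormal_basis_exists by blast
  have "(\<Sum>e\<in>E. wedge (iota e (structure_form br B)) (iota e \<omega>) ys) =
      (\<Sum>e\<in>E. \<Sum>j<length ys. \<Sum>i<j. (- 1) ^ (i + j + 1) *
        (structure_form br B [e, ys ! i, ys ! j] * \<omega> (e # nths ys (- {i, j}))))"
    by (subst wedge_2_left) (auto simp: iota_def structure_form_eq_0 mult.assoc)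
  also have "\<dots> = (\<Sum>j<length ys. \<Sum>i<j. (- 1) ^ (i + j + 1) *
      (\<Sum>e\<in>E. structure_form br B [e, ys ! i, ys ! j] * \<omega> (e # nths ys (- {i, j}))))"
    unfolding sum_distrib_left by (subst sum.swap, intro sum.cong refl, rule sum.swap)
  also have "\<dots> = - chevalley_d br \<omega> ys"
    unfolding structure_form_contraction[OF E \<omega>] chevalley_d_def by (simp add: sum_negf)
  \<comment> \<open>In degree \<open>w = 3\<close> the prefactor of the bracket is
    \<open>+2\<close>, so the minus sign comes from the shuffles alone.\<close>
  finally show ?thesis
    by (simp add: poisson_eq[OF E structure_form_alt \<omega>])
qed

lemma chevalley_d_structure_form: "chevalley_d br (structure_form br B) ys = 0"
proof (cases "length ys = 4")
  case True
  then obtain a b c d where ys: "ys = [a, b, c, d]"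
    by (auto simp: numeral_eq_Suc length_Suc_conv)
  have "chevalley_d br (structure_form br B) ys =
      - B (br (br a b) c) d + B (br (br a c) b) d - B (br (br b c) a) d
      - B (br (br a d) b) c + B (br (br b d) a) c - B (br (br c d) a) b"
    by (simp add: chevalley_d_def ys lessThan_Suc numeral_eq_Suc nths_Cons structure_form_3)
  \<comment> \<open>Each of the three splittings of \<open>{a, b, c, d}\<close> into two pairs
    arises from two of the six terms, whence the factor 2.\<close>
  also have "\<dots> = 2 * (B (br a c) (br b d) - B (br a b) (br c d) - B (br a d) (br b c))"
    by (simp add: B_br_assoc[of "br _ _"] B_sym[of "br b c" "br a d"] B_sym[of "br b d" "br a c"]
        B_sym[of "br c d" "br a b"])
  \<comment> \<open>Moving \<open>a\<close> out gives \<open>B a (br b (br c d))\<close>; expanding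
    \<open>br b\<close> as a derivation is where the Jacobi identity enters.\<close>
  also have "B (br a b) (br c d) = B (br a c) (br b d) - B (br a d) (br b c)"
    unfolding B_br_assoc[of a] br_derivation[of b c d]
    using br_antisym[of "br b c" d] by (simp add: B_simps B_minus)
  finally show ?thesis by simp
next
  case False
  \<comment> \<open>Together with the bracket put in front, \<open>I\<close> receives
    \<open>length ys - 1\<close> arguments, a number different from 3 here.\<close>
  have "length (nths ys (- {i, j})) = length ys - 2" if "i < j" "j < length ys" for i j
  proof -
    have "{k. k < length ys \<and> k \<in> - {i, j}} = {..<length ys} - {i, j}" by auto
    then show ?thesis using that by (simp add: length_nths card_Diff_subset)
  qed
  then show ?thesis using False
    unfolding chevalley_d_def by (auto intro!: sum.neutral structure_form_eq_0)
qed

end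

theorem proposition5p5p1:
  fixes scale :: "complex \<Rightarrow> 'g::ab_group_add \<Rightarrow> 'g" and Basis :: "'g set"
    and br :: "'g \<Rightarrow> 'g \<Rightarrow> 'g" and B :: "'g \<Rightarrow> 'g \<Rightarrow> complex"
  assumes "quadratic_lie_algebra scale Basis br B"
  shows "(structure_form br B \<in> alt_forms scale 3 \<and> invariant_form br (structure_form br B)) \<and>
    (\<forall>\<omega>\<in>ext_alg scale.
       chevalley_d br \<omega> = (\<lambda>ys. - (1 / 2) * ad_P scale B (structure_form br B) \<omega> ys)) \<and>
    poisson scale B (structure_form br B) (structure_form br B) = (\<lambda>ys. 0)"
proof -
  interpret quadratic_lie_algebra scale Basis br B by (rule assms)
  show ?thesis
    by (simp add: structure_form_alt structure_form_invariant ad_P_def poisson_structure_form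
        structure_form_ext_alg chevalley_d_structure_form fun_eq_iff)
qed

end
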